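(* Let $\alpha>1/2$. There is no online algorithm for the lax static case of unweighted \textsc{MaximumIndependentSet} in unit disk graphs that has competitive ratio $\alpha$ and an amortized migration factor bounded by a constant (independent of the instance), when the migration potential of a step is the area difference of consecutive instances.
   Context: Unit disk graph: the vertices are closed disks of radius $1$ in the plane, and two vertices are adjacent iff the disks intersect (tangent disks count as intersecting). An independent set is a set of pairwise non-intersecting disks, and its profit is its cardinality. Lax static case: at time $1$ an arbitrary set of disks $I_1$ is presented, contributing no migration potential. Afterwards, at each step one disk arrives, and disks never depart. The algorithm outputs an independent set $S_t$ at each time without knowledge of the future. Competitive ratio $\alpha$ means $|S_t|\ge\alpha\,\mathrm{opt}(I_t)$ for all $t$. The migration potential of step $t\ge 2$ is $\mathrm{area}(I_t)-\mathrm{area}(I_{t-1})$, where $\mathrm{area}(I)$ is the area of the union of the disks in $I$. The migration cost of changing $S_{t-1}$ to $S_t$ is the total area of the disks in $S_{t-1}\triangle S_t$ (i.e. $\pi$ per disk), excluding the initial inclusion of a newly arrived disk. A bounded amortized migration factor $B$ means that for all $t$ the total migration cost up to $t$ is at most $B$ times the total migration potential up to $t$. *)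

theory Defs
  imports "HOL-Analysis.Analysis"
begin

type_synonym disk = "(real^2) set"

definition unit_disk :: "disk \<Rightarrow> bool" where
  "unit_disk D \<longleftrightarrow> (\<exists>c. D = cball c 1)"

text \<open>The disks are closed, so tangent disks count as intersecting.\<close>

definition independent_disks :: "disk set \<Rightarrow> bool" where
  "independent_disks S \<longleftrightarrow> pairwise disjnt S"

definition opt :: "disk set \<Rightarrow> nat" where
  "opt I = Max (card ` {S. S \<subseteq> I \<and> independent_disks S})"

definition area :: "disk set \<Rightarrow> real" where
  "area I = measure lebesgue (\<Union>I)"

text \<open>
  An input consists of the set \<open>I1\<close> of disks presented at time 1 and the list \<open>ds\<close> of disks
  that arrive afterwards. Times run from 1 to \<open>length ds + 1\<close>; the disk arriving at time
  \<open>t \<ge> 2\<close> is \<open>ds ! (t - 2)\<close>, and it is not yet present before time \<open>t\<close>.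
\<close>

definition lax_static_input :: "disk set \<Rightarrow> disk list \<Rightarrow> bool" where
  "lax_static_input I1 ds \<longleftrightarrow>
     finite I1 \<and> (\<forall>D \<in> I1 \<union> set ds. unit_disk D) \<and> distinct ds \<and> I1 \<inter> set ds = {}"

definition times :: "disk list \<Rightarrow> nat set" where
  "times ds = {1..length ds + 1}"

definition arrival :: "disk list \<Rightarrow> nat \<Rightarrow> disk" where
  "arrival ds t = ds ! (t - 2)"

definition instance_at :: "disk set \<Rightarrow> disk list \<Rightarrow> nat \<Rightarrow> disk set" where
  "instance_at I1 ds t = I1 \<union> set (take (t - 1) ds)"

text \<open>
  A deterministic online algorithm maps the history seen so far (the initial set and the list of
  disks that have arrived since) to its current output. Its own earlier outputs are functions of
  that history and need not be passed separately.
\<close>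

type_synonym online_algorithm = "disk set \<Rightarrow> disk list \<Rightarrow> disk set"

definition solution_at :: "online_algorithm \<Rightarrow> disk set \<Rightarrow> disk list \<Rightarrow> nat \<Rightarrow> disk set" where
  "solution_at A I1 ds t = A I1 (take (t - 1) ds)"

definition outputs_independent_sets :: "online_algorithm \<Rightarrow> bool" where
  "outputs_independent_sets A \<longleftrightarrow>
     (\<forall>I1 ds. lax_static_input I1 ds \<longrightarrow>
       (\<forall>t \<in> times ds. solution_at A I1 ds t \<subseteq> instance_at I1 ds t \<and>
                       independent_disks (solution_at A I1 ds t)))"

definition has_competitive_ratio :: "online_algorithm \<Rightarrow> real \<Rightarrow> bool" where
  "has_competitive_ratio A \<alpha> \<longleftrightarrow>
     (\<forall>I1 ds. lax_static_input I1 ds \<longrightarrow>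
       (\<forall>t \<in> times ds.
          real (card (solution_at A I1 ds t)) \<ge> \<alpha> * real (opt (instance_at I1 ds t))))"

definition migration_potential :: "disk set \<Rightarrow> disk list \<Rightarrow> nat \<Rightarrow> real" where
  "migration_potential I1 ds t = area (instance_at I1 ds t) - area (instance_at I1 ds (t - 1))"

text \<open>
  The disk arriving at time \<open>t\<close> cannot be in the previous solution, so dropping it from the
  symmetric difference exempts exactly its inclusion upon arrival.
\<close>

definition migration_cost :: "online_algorithm \<Rightarrow> disk set \<Rightarrow> disk list \<Rightarrow> nat \<Rightarrow> real" where
  "migration_cost A I1 ds t =
     (\<Sum>D \<in> sym_diff (solution_at A I1 ds (t - 1)) (solution_at A I1 ds t) - {arrival ds t}.
        measure lebesgue D)"

definition amortized_migration_factor_le :: "online_algorithm \<Rightarrow> real \<Rightarrow> bool" where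
  "amortized_migration_factor_le A B \<longleftrightarrow>
     (\<forall>I1 ds. lax_static_input I1 ds \<longrightarrow>
       (\<forall>t \<in> times ds.
          (\<Sum>s = 2..t. migration_cost A I1 ds s) \<le> B * (\<Sum>s = 2..t. migration_potential I1 ds s)))"

end

theory Submission
  imports Defs
begin

text \<open>
  At time 1 present the four disks with centres \<open>\<plusminus>e\<close> and \<open>\<plusminus>f\<close> for orthonormal \<open>e\<close>, \<open>f\<close>. They
  pairwise intersect, so the algorithm selects exactly one of them, with centre \<open>c\<close> say. Pick
  \<open>v \<in> {e, f}\<close> orthogonal to \<open>c\<close> and let the disks with centres \<open>\<plusminus>(1 + \<epsilon>) v\<close> arrive. They are
  disjoint, so two disks have to be selected eventually; as the disk around \<open>c\<close> still meets
  every other disk, it must be given up. This costs one disk area, whereas the potential is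
  \<open>O(\<epsilon>)\<close> because the arriving disks nearly coincide with those around \<open>\<plusminus>v\<close>.
\<close>

text \<open>The midpoint is the decisive point: it lies in both balls as soon as any point does, by
  the triangle inequality.\<close>

lemma disjnt_cball_iff:
  fixes a b :: "'a::real_normed_vector"
  shows "disjnt (cball a r) (cball b r) \<longleftrightarrow> dist a b > 2 * r"
proof
  assume disj: "disjnt (cball a r) (cball b r)"
  have "dist a (midpoint a b) = dist a b / 2" "dist b (midpoint a b) = dist a b / 2"
    by (simp_all add: dist_midpoint)
  with disj have "\<not> dist a b / 2 \<le> r"
    unfolding disjnt_iff mem_cball by metis
  then show "dist a b > 2 * r" by simp
next
  assume far: "dist a b > 2 * r"
  show "disjnt (cball a r) (cball b r)"
    unfolding disjnt_iff mem_cball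
  proof (intro allI notI)
    fix x
    assume "dist a x \<le> r \<and> dist b x \<le> r"
    with far dist_triangle2[of a b x] show False by linarith
  qed
qed

lemma le_opt:
  assumes "finite I" "S \<subseteq> I" "independent_disks S"
  shows "card S \<le> opt I"
  unfolding opt_def using assms by (intro Max_ge) auto

lemma measure_cball_plane:
  fixes c :: "real^2"
  assumes "r \<ge> 0"
  shows "measure lebesgue (cball c r) = unit_ball_vol 2 * r\<^sup>2"
  using content_cball[OF assms, of c] by simp

text \<open>The crescent lies in the annulus around \<open>v\<close> with radii 1 and
  \<open>1 + \<epsilon>\<close>, so its area vanishes with \<epsilon>.\<close>

lemma measure_shifted_disk_diff_le:
  fixes v w :: "real^2"
  assumes "dist v w \<le> \<epsilon>"
  shows "measure lebesgue (cball w 1 - cball v 1) \<le> unit_ball_vol 2 * (2 * \<epsilon> + \<epsilon>\<^sup>2)"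
proof -
  have "\<epsilon> \<ge> 0" using assms zero_le_dist[of v w] by linarith
  have "cball w 1 \<subseteq> cball v (1 + \<epsilon>)"
    using assms by (auto simp: subset_iff) (smt (verit) dist_triangle)
  then have "measure lebesgue (cball w 1 - cball v 1)
      \<le> measure lebesgue (cball v (1 + \<epsilon>) - cball v 1)"
    by (intro measure_mono_fmeasurable fmeasurable_Diff) auto
  also have "\<dots> = measure lebesgue (cball v (1 + \<epsilon>)) - measure lebesgue (cball v 1)"
    using \<open>\<epsilon> \<ge> 0\<close> by (intro measurable_measure_Diff) auto
  also have "\<dots> = unit_ball_vol 2 * (2 * \<epsilon> + \<epsilon>\<^sup>2)"
    using \<open>\<epsilon> \<ge> 0\<close> measure_cball_plane[of "1 + \<epsilon>" v] measure_cball_plane[of 1 v]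
    by (simp add: power2_eq_square algebra_simps)
  finally show ?thesis .
qed

lemma lmeasurable_Union_unit_disks:
  assumes "finite I" "\<forall>D \<in> I. unit_disk D"
  shows "\<Union>I \<in> lmeasurable"
  using assms by (intro fmeasurable.finite_Union) (auto simp: unit_disk_def)

text \<open>Each arriving disk enlarges the union by at most its crescent outside the nearby old
  disk; overlaps of the two crescents only help.\<close>

lemma area_two_arrivals_le:
  fixes v w v' w' :: "real^2"
  assumes "finite I" "\<forall>D \<in> I. unit_disk D"
    and "cball v 1 \<in> I" "dist v w \<le> \<epsilon>" "cball v' 1 \<in> I" "dist v' w' \<le> \<epsilon>"
  shows "area (I \<union> {cball w 1, cball w' 1}) - area I \<le> 2 * unit_ball_vol 2 * (2 * \<epsilon> + \<epsilon>\<^sup>2)"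
proof -
  have meas: "\<Union>I \<in> lmeasurable"
    using assms(1,2) by (rule lmeasurable_Union_unit_disks)
  let ?E = "cball w 1 - cball v 1" and ?E' = "cball w' 1 - cball v' 1"
  have E: "?E \<in> lmeasurable" "?E' \<in> lmeasurable"
    by (auto intro: fmeasurable_Diff)
  have "\<Union>(I \<union> {cball w 1, cball w' 1}) = \<Union>I \<union> (?E \<union> ?E')"
    using assms by auto
  then have "area (I \<union> {cball w 1, cball w' 1}) \<le> area I + measure lebesgue (?E \<union> ?E')"
    unfolding area_def using meas E by (metis measure_Un_le fmeasurable.Un fmeasurableD)
  also have "measure lebesgue (?E \<union> ?E') \<le> measure lebesgue ?E + measure lebesgue ?E'"
    using E by (intro measure_Un_le fmeasurableD)
  also have "\<dots> \<le> 2 * unit_ball_vol 2 * (2 * \<epsilon> + \<epsilon>\<^sup>2)"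
    using measure_shifted_disk_diff_le[OF assms(4)] measure_shifted_disk_diff_le[OF assms(6)]
    by linarith
  finally show ?thesis by simp
qed

lemma sum_migration_potential:
  assumes "t \<ge> 1"
  shows "(\<Sum>s = 2..t. migration_potential I ds s) = area (instance_at I ds t) - area I"
  using assms
proof (induction t rule: dec_induct)
  case base
  then show ?case by (simp add: instance_at_def)
next
  case (step n)
  \<comment> \<open>This relies on \<open>1 \<le> n\<close>, supplied by \<open>dec_induct\<close>;
    for \<open>n = 1\<close> the interval \<open>{2..n}\<close> is empty.\<close>
  then have "{2..Suc n} = insert (Suc n) {2..n}" by auto
  with step show ?case by (simp add: migration_potential_def)
qed

lemma migration_cost_ge:
  assumes "outputs_independent_sets A" "lax_static_input I ds" "t \<in> times ds" "t \<ge> 2"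
    and "D \<in> solution_at A I ds (t - 1)" "D \<notin> solution_at A I ds t" "D \<noteq> arrival ds t"
  shows "measure lebesgue D \<le> migration_cost A I ds t"
proof -
  \<comment> \<open>A sum over an infinite set is 0 by default, so the bound by a single summand
    requires finiteness.\<close>
  have fin: "finite (solution_at A I ds s)" if "s \<in> times ds" for s
  proof (rule finite_subset)
    show "solution_at A I ds s \<subseteq> instance_at I ds s"
      using assms(1,2) that unfolding outputs_independent_sets_def by blast
    show "finite (instance_at I ds s)"
      using assms(2) by (simp add: lax_static_input_def instance_at_def)
  qed
  have "t - 1 \<in> times ds" using assms(3,4) by (auto simp: times_def)
  then have "finite (sym_diff (solution_at A I ds (t - 1)) (solution_at A I ds t) - {arrival ds t})"
    using fin assms(3) by simp
  then show ?thesis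
    unfolding migration_cost_def using assms(5-7)
    by (intro member_le_sum[where f = "measure lebesgue"]) auto
qed

lemma migration_cost_nonneg: "0 \<le> migration_cost A I ds t"
  unfolding migration_cost_def by (intro sum_nonneg) auto

text \<open>A disk lost by time \<open>t\<close> is dropped at some first step, whichever it is, and
  is paid for there. Being a disk of time 1 and not an arrival, it never falls under the
  exemption.\<close>

lemma sum_migration_cost_ge:
  assumes "outputs_independent_sets A" "lax_static_input I ds" "t \<in> times ds"
    and "D \<in> solution_at A I ds 1" "D \<notin> solution_at A I ds t" "D \<notin> set ds"
  shows "measure lebesgue D \<le> (\<Sum>s = 2..t. migration_cost A I ds s)"
proof -
  define s where "s = (LEAST s. s \<ge> 1 \<and> D \<notin> solution_at A I ds s)"
  have "t \<ge> 1" using assms(3) by (simp add: times_def)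
  then have s: "s \<ge> 1" "D \<notin> solution_at A I ds s" "s \<le> t"
    using assms(5) LeastI[of "\<lambda>s. s \<ge> 1 \<and> D \<notin> solution_at A I ds s" t]
      Least_le[of "\<lambda>s. s \<ge> 1 \<and> D \<notin> solution_at A I ds s" t] unfolding s_def by auto
  have "s \<ge> 2" using s assms(4) by (cases "s = 1") auto
  have before: "D \<in> solution_at A I ds (s - 1)"
    using not_less_Least[of "s - 1" "\<lambda>s. s \<ge> 1 \<and> D \<notin> solution_at A I ds s"] \<open>s \<ge> 2\<close>
    unfolding s_def[symmetric] by auto
  have times: "s \<in> times ds" using s assms(3) by (auto simp: times_def)
  then have "s - 2 < length ds" using \<open>s \<ge> 2\<close> by (auto simp: times_def)
  then have "D \<noteq> arrival ds s" using assms(6) nth_mem by (auto simp: arrival_def)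
  then have "measure lebesgue D \<le> migration_cost A I ds s"
    using assms(1,2) times \<open>s \<ge> 2\<close> before s(2) by (intro migration_cost_ge)
  also have "\<dots> \<le> (\<Sum>s = 2..t. migration_cost A I ds s)"
    using \<open>s \<ge> 2\<close> s(3) by (intro member_le_sum migration_cost_nonneg) auto
  finally show ?thesis .
qed

theorem theorem22:
  fixes \<alpha> :: real
  assumes "\<alpha> > 1/2"
  shows "\<not> (\<exists>A. outputs_independent_sets A \<and> has_competitive_ratio A \<alpha> \<and>
               (\<exists>B. amortized_migration_factor_le A B))"
proof
  assume "\<exists>A. outputs_independent_sets A \<and> has_competitive_ratio A \<alpha> \<and>
               (\<exists>B. amortized_migration_factor_le A B)"
  then obtain A B where indep: "outputs_independent_sets A"
    and ratio: "has_competitive_ratio A \<alpha>" and migr: "amortized_migration_factor_le A B"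
    by blast
  define e f :: "real^2" where "e = axis 1 1" and "f = axis 2 1"
  have ef: "norm e = 1" "norm f = 1" "e \<bullet> f = 0" "f \<bullet> e = 0"
    by (auto simp: e_def f_def inner_axis_axis)
  define C where "C = {e, -e, f, -f}"
  define I where "I = (\<lambda>c. cball c 1) ` C"
  have norm_C: "norm c = 1" if "c \<in> C" for c using that ef by (auto simp: C_def)
  have I: "finite I" "\<forall>D \<in> I. unit_disk D"
    by (auto simp: I_def C_def unit_disk_def)

  \<comment> \<open>The run without arrivals reveals \<open>A I []\<close>, which is also the
    solution at time 1 of every continuation. Hence the arrivals may be chosen depending on
    it.\<close>
  have "lax_static_input I []" using I by (simp add: lax_static_input_def)
  then have first: "\<alpha> * real (opt I) \<le> real (card (A I []))" "A I [] \<subseteq> I"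
    using ratio indep
    unfolding has_competitive_ratio_def outputs_independent_sets_def times_def solution_at_def
      instance_at_def by force+
  have "card {cball e 1} \<le> opt I"
    using I by (intro le_opt) (auto simp: I_def C_def independent_disks_def)
  then have "\<alpha> * real (opt I) > 0" using assms by simp
  then have "A I [] \<noteq> {}" using first(1) by auto
  then obtain c where c: "c \<in> C" "cball c 1 \<in> A I []"
    using first(2) by (fastforce simp: I_def)
  obtain v where v: "v \<in> C" "- v \<in> C" "c \<bullet> v = 0"
    using c(1) ef unfolding C_def by fastforce

  \<comment> \<open>Small enough for the final estimate, where
    \<open>2 * (1/8) * (2 + 1/8) = 17/32 < 1\<close>. The summand 1 covers
    \<open>B = 0\<close>.\<close>
  define \<epsilon> where "\<epsilon> = 1 / (8 * (\<bar>B\<bar> + 1))"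
  have \<epsilon>: "0 < \<epsilon>" "\<epsilon> \<le> 1/8" "\<bar>B\<bar> * \<epsilon> < 1/8"
    by (auto simp: \<epsilon>_def field_simps)
  define w where "w = (1 + \<epsilon>) *\<^sub>R v"
  define ds where "ds = [cball w 1, cball (- w) 1]"
  have norm_w: "norm w = 1 + \<epsilon>" using norm_C[OF v(1)] \<epsilon>(1) by (simp add: w_def)
  have "w - - w = 2 *\<^sub>R w" by (simp add: scaleR_2)
  then have dist_w: "dist w (- w) = 2 * (1 + \<epsilon>)"
    by (metis dist_norm norm_scaleR norm_w abs_numeral)
  then have "w \<noteq> - w" using \<epsilon>(1) zero_less_dist_iff[of w "- w"] by simp
  moreover have new: "w \<notin> C" "- w \<notin> C"
    using norm_C[of w] norm_C[of "- w"] norm_w \<epsilon>(1) by auto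
  ultimately have input: "lax_static_input I ds"
    using I by (auto simp: lax_static_input_def ds_def unit_disk_def I_def cball_eq_cball_iff)
  have inst: "instance_at I ds 3 = I \<union> {cball w 1, cball (- w) 1}"
    by (simp add: instance_at_def ds_def)
  have times: "3 \<in> times ds" by (simp add: times_def ds_def)
  \<comment> \<open>Both disks are present at time 3. Whether the old disk is dropped at time 2 or 3
    is immaterial, since costs are summed.\<close>
  define S where "S = solution_at A I ds 3"
  have S: "S \<subseteq> I \<union> {cball w 1, cball (- w) 1}" "independent_disks S"
    using indep input times unfolding outputs_independent_sets_def S_def inst[symmetric] by auto

  have "independent_disks {cball w 1, cball (- w) 1}"
    using dist_w \<epsilon>(1)
    by (auto simp: independent_disks_def pairwise_insert disjnt_cball_iff dist_commute)
  moreover have "card {cball w 1, cball (- w) 1} = 2"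
    using \<open>w \<noteq> - w\<close> by (simp add: cball_eq_cball_iff)
  ultimately have "2 \<le> opt (instance_at I ds 3)"
    using le_opt[of "instance_at I ds 3" "{cball w 1, cball (- w) 1}"] I(1) by (simp add: inst)
  \<comment> \<open>The threshold 1/2 enters here: a bound strictly above 1 forces an integer
    cardinality of at least 2.\<close>
  then have "\<alpha> * real (opt (instance_at I ds 3)) > 1"
    using assms mult_left_mono[of 2 "real (opt (instance_at I ds 3))" \<alpha>] by linarith
  moreover have "\<alpha> * real (opt (instance_at I ds 3)) \<le> real (card S)"
    using ratio input times unfolding has_competitive_ratio_def S_def by blast
  ultimately have card_S: "card S > 1" by linarith

  \<comment> \<open>Old centres are at distance at most 2 from \<open>c\<close>, with tangency at
    \<open>-c\<close>. New centres are orthogonal to \<open>c\<close>, so Pythagoras gives a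
    distance near \<open>sqrt 2\<close>, well below 2.\<close>
  have meets: "\<not> disjnt (cball c 1) D" if "D \<in> I \<union> {cball w 1, cball (- w) 1}" for D
  proof -
    from that have "\<exists>x. D = cball x 1 \<and> (x \<in> C \<or> x = w \<or> x = - w)"
      unfolding I_def by blast
    then obtain x where x: "D = cball x 1" "x \<in> C \<or> x = w \<or> x = - w"
      by blast
    have "dist c x \<le> 2"
    proof (cases "x \<in> C")
      case True
      then show ?thesis
        using norm_triangle_ineq4[of c x] norm_C[OF True] norm_C[OF c(1)] by (simp add: dist_norm)
    next
      case False
      then have "c \<bullet> x = 0" "norm x = 1 + \<epsilon>" using x(2) v(3) norm_w by (auto simp: w_def)
      then have "(dist c x)\<^sup>2 = 1 + (1 + \<epsilon>)\<^sup>2"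
        using norm_C[OF c(1)]
        by (simp add: dist_norm power2_norm_eq_inner inner_diff inner_commute flip: dot_square_norm)
          (simp add: dot_square_norm)
      also have "\<dots> \<le> 1 + (1 + 1/8)\<^sup>2" using \<epsilon> by (intro add_left_mono power_mono) auto
      also have "\<dots> \<le> 2\<^sup>2" by (simp add: power2_eq_square)
      finally show ?thesis by (rule power2_le_imp_le) simp
    qed
    then show ?thesis by (simp add: x(1) disjnt_cball_iff)
  qed
  have "cball c 1 \<notin> S"
  proof
    assume "cball c 1 \<in> S"
    then have "S = {cball c 1}"
      using S meets unfolding independent_disks_def pairwise_def by blast
    with card_S show False by simp
  qed

  then have "measure lebesgue (cball c 1) \<le> (\<Sum>s = 2..3. migration_cost A I ds s)"
    using c new indep input times
    by (intro sum_migration_cost_ge)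
      (auto simp: S_def solution_at_def ds_def cball_eq_cball_iff)
  also have "\<dots> \<le> B * (\<Sum>s = 2..3. migration_potential I ds s)"
    using migr input times unfolding amortized_migration_factor_le_def by blast
  also have "(\<Sum>s = 2..3. migration_potential I ds s) = area (instance_at I ds 3) - area I"
    by (rule sum_migration_potential) simp
  \<comment> \<open>The sign of \<open>B\<close> is unknown; passing to \<open>\<bar>B\<bar>\<close>
    is sound because the area does not decrease.\<close>
  also have "B * (area (instance_at I ds 3) - area I)
      \<le> \<bar>B\<bar> * (2 * unit_ball_vol 2 * (2 * \<epsilon> + \<epsilon>\<^sup>2))"
  proof (intro mult_mono)
    \<comment> \<open>Each arrival is compared with the old disk in the same direction, from which
      it is shifted radially by \<epsilon>.\<close>
    have "dist v w = \<epsilon>" "dist (- v) (- w) = \<epsilon>"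
      using norm_C[OF v(1)] \<epsilon>(1) by (simp_all add: w_def dist_norm algebra_simps)
    then show "area (instance_at I ds 3) - area I \<le> 2 * unit_ball_vol 2 * (2 * \<epsilon> + \<epsilon>\<^sup>2)"
      unfolding inst using I v by (intro area_two_arrivals_le[of _ v _ _ "- v"]) (auto simp: I_def)
    have "\<Union>(instance_at I ds 3) \<in> lmeasurable" "\<Union>I \<in> lmeasurable"
      using I by (intro lmeasurable_Union_unit_disks; auto simp: inst unit_disk_def)+
    then show "0 \<le> area (instance_at I ds 3) - area I"
      unfolding area_def inst by (simp, intro measure_mono_fmeasurable) auto
  qed auto
  also have "\<dots> = unit_ball_vol 2 * (2 * (\<bar>B\<bar> * \<epsilon>) * (2 + \<epsilon>))"
    by (simp add: power2_eq_square algebra_simps)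
  also have "\<dots> < unit_ball_vol 2 * 1"
  proof (intro mult_strict_left_mono)
    have "2 * (\<bar>B\<bar> * \<epsilon>) * (2 + \<epsilon>) \<le> 2 * (1/8) * (2 + 1/8)"
      using \<epsilon> by (intro mult_mono) auto
    then show "2 * (\<bar>B\<bar> * \<epsilon>) * (2 + \<epsilon>) < 1" by simp
  qed simp
  finally show False using measure_cball_plane[of 1 c] by simp
qed

end
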